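(* Let $p\ge 2$ and let $\phi=(\phi_1,\dots,\phi_p)^\top:[0,1]\to\mathbb{R}^p$ be a vector of $p$ functions that are orthonormal in $L_2([0,1])$ and such that $\phi_1(t)=1$ for all $t\in[0,1]$. Then $\mathcal{C}_\phi$ is a non-empty set of copula densities; that is, $\mathcal{C}_\phi\neq\emptyset$ and every $c\in\mathcal{C}_\phi$ is the density of a bivariate copula.
   Context: $e_1$ is the first vector of the canonical basis of $\mathbb{R}^p$. Orthonormality means $\int_0^1\phi_i(t)\phi_j(t)\,dt=\delta_{ij}$ for $1\le i,j\le p$. Define $$\mathcal{A}_\phi=\{A\in\mathbb{R}^{p\times p}:\ Ae_1=e_1,\ A^\top e_1=e_1,\ \phi(u)^\top A\,\phi(v)\ge 0\ \ \forall (u,v)\in[0,1]^2\},$$ $$\mathcal{C}_\phi=\{c:[0,1]^2\to\mathbb{R}:\ c(u,v)=\phi(u)^\top A\,\phi(v)\ \ \forall (u,v)\in[0,1]^2, \text{ for some } A\in\mathcal{A}_\phi\}.$$ A bivariate copula is a bivariate cumulative distribution function on $[0,1]^2$ with univariate margins uniform on $[0,1]$; a copula density is a nonnegative function on $[0,1]^2$ that is the density of such a distribution (both marginal densities equal to $1$). *)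

theory Defs
  imports "HOL-Probability.Probability" "Jordan_Normal_Form.Matrix"
begin

abbreviation unit_square :: "(real \<times> real) set" where
  "unit_square \<equiv> {0..1} \<times> {0..1}"

(* Vectors of R^p are indexed from 0, so the function phi_i is component i - 1, and the first
   canonical basis vector e_1 is unit_vec p 0. A function of [0,1] is a total function whose
   values outside [0,1] are never used. *)

definition orthonormal_L2 :: "nat \<Rightarrow> (real \<Rightarrow> real vec) \<Rightarrow> bool" where
  "orthonormal_L2 p \<phi> \<longleftrightarrow>
     (\<forall>i<p. (\<lambda>t. vec_index (\<phi> t) i) \<in> borel_measurable (lebesgue_on {0..1}) \<and>
            integrable (lebesgue_on {0..1}) (\<lambda>t. (vec_index (\<phi> t) i)\<^sup>2)) \<and>
     (\<forall>i<p. \<forall>j<p. (LINT t|lebesgue_on {0..1}. vec_index (\<phi> t) i * vec_index (\<phi> t) j)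
                    = (if i = j then 1 else 0))"

definition A_set :: "nat \<Rightarrow> (real \<Rightarrow> real vec) \<Rightarrow> real mat set" where
  "A_set p \<phi> = {A \<in> carrier_mat p p.
     A *\<^sub>v unit_vec p 0 = unit_vec p 0 \<and>
     transpose_mat A *\<^sub>v unit_vec p 0 = unit_vec p 0 \<and>
     (\<forall>u\<in>{0..1}. \<forall>v\<in>{0..1}. scalar_prod (\<phi> u) (A *\<^sub>v \<phi> v) \<ge> 0)}"

(* The extensional function space makes the members genuine functions on [0,1]^2: each is
   determined by its values there. *)

definition C_set :: "nat \<Rightarrow> (real \<Rightarrow> real vec) \<Rightarrow> (real \<times> real \<Rightarrow> real) set" where
  "C_set p \<phi> = {c \<in> unit_square \<rightarrow>\<^sub>E UNIV.
     \<exists>A\<in>A_set p \<phi>. \<forall>u\<in>{0..1}. \<forall>v\<in>{0..1}. c (u, v) = scalar_prod (\<phi> u) (A *\<^sub>v \<phi> v)}"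

(* C is, on the unit square, the cumulative distribution function of a Borel probability measure
   that is concentrated on the unit square and has uniform margins. *)

definition bivariate_copula :: "(real \<times> real \<Rightarrow> real) \<Rightarrow> bool" where
  "bivariate_copula C \<longleftrightarrow>
     (\<exists>M. prob_space M \<and> sets M = sets borel \<and> emeasure M unit_square = 1 \<and>
          distr M borel fst = uniform_measure lborel {0..1} \<and>
          distr M borel snd = uniform_measure lborel {0..1} \<and>
          (\<forall>u\<in>{0..1}. \<forall>v\<in>{0..1}. C (u, v) = measure M ({..u} \<times> {..v})))"

definition density_of_cdf :: "(real \<times> real \<Rightarrow> real) \<Rightarrow> (real \<times> real \<Rightarrow> real) \<Rightarrow> bool" where
  "density_of_cdf c C \<longleftrightarrow>
     integrable (lebesgue_on unit_square) c \<and>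
     (\<forall>u\<in>{0..1}. \<forall>v\<in>{0..1}. C (u, v) = (LINT x|lebesgue_on ({0..u} \<times> {0..v}). c x))"

(* Nonnegativity is required at every point of the square. The marginal densities are determined
   only up to null sets, so their being 1 is stated almost everywhere; it also follows from the
   uniform margins of the copula. *)

definition copula_density :: "(real \<times> real \<Rightarrow> real) \<Rightarrow> bool" where
  "copula_density c \<longleftrightarrow>
     (\<forall>x\<in>unit_square. c x \<ge> 0) \<and>
     (\<exists>C. bivariate_copula C \<and> density_of_cdf c C) \<and>
     (AE u in lebesgue_on {0..1}. (LINT v|lebesgue_on {0..1}. c (u, v)) = 1) \<and>
     (AE v in lebesgue_on {0..1}. (LINT u|lebesgue_on {0..1}. c (u, v)) = 1)"

end

theory Submission
  imports Defs
begin

no_notation Finite_Cartesian_Product.vec_nth (infixl "$" 90)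
no_notation inner (infix "\<bullet>" 70)

text \<open>
  Write \<open>c (u, v) = \<phi>(u)\<^sup>T A \<phi>(v)\<close>, with indices starting from 0. Because \<open>\<phi>\<^sub>0\<close> is the constant 1,
  orthonormality says that \<open>\<phi>\<^sub>0\<close> has integral 1 and every other \<open>\<phi>\<^sub>i\<close> has integral 0. Integrating
  \<open>c\<close> over \<open>v\<close> thus replaces the vector \<open>\<phi>(v)\<close> by the first unit vector, which \<open>A\<close> fixes, and what
  remains is \<open>\<phi>\<^sub>0(u) = 1\<close>. The transposed condition gives the other margin in the same way. As \<open>c\<close> is
  nonnegative by the choice of \<open>A\<close>, it is the density of a probability measure with uniform margins
  (\<open>copula_density_of_mem_C_set\<close>). The constant function 1, obtained from the matrix unit in the
  first row and column, shows that the set is not empty (\<open>constant_one_in_C_set\<close>).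

  The measure theory lies in the passage from a function to a copula (\<open>copula_densityI\<close>). The
  functions \<open>\<phi>\<^sub>i\<close> are only Lebesgue measurable, whereas a copula is given by a Borel measure on the
  plane. The function \<open>c\<close> is shown to be Lebesgue measurable on the square; a Borel function equal to
  it almost everywhere then defines the measure, and Fubini's theorem transfers the integrals of
  the slices from \<open>c\<close> to that function.
\<close>

section \<open>Lebesgue measurability in the plane\<close>

text \<open>
  Borel measurability of a projection does not suffice to compose it with a Lebesgue measurable
  function: preimages of null sets must be null as well, which holds because the product of a null
  set with a whole space is null.
\<close>

lemma fst_lebesgue_measurable:
  "fst \<in> (lebesgue :: ('a::euclidean_space \<times> 'b::euclidean_space) measure) \<rightarrow>\<^sub>M lebesgue"
proof (rule completion.measurable_completion2)
  show fst_borel: "fst \<in> (lebesgue :: ('a \<times> 'b) measure) \<rightarrow>\<^sub>M lborel"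
    by (intro measurable_completion) (simp add: borel_measurable_continuous_onI continuous_on_fst)
  show "null_sets lborel \<subseteq> null_sets (distr (lebesgue :: ('a \<times> 'b) measure) lborel fst)"
  proof
    fix N :: "'a set" assume N: "N \<in> null_sets lborel"
    have "N \<times> (UNIV :: 'b set) \<in> null_sets ((lborel :: 'a measure) \<Otimes>\<^sub>M (lborel :: 'b measure))"
      using N by (intro lborel.times_in_null_sets1) auto
    then have "N \<times> (UNIV :: 'b set) \<in> null_sets (lebesgue :: ('a \<times> 'b) measure)"
      by (simp add: lborel_prod null_sets_completionI)
    moreover have "fst -` N = N \<times> (UNIV :: 'b set)" by auto
    ultimately show "N \<in> null_sets (distr (lebesgue :: ('a \<times> 'b) measure) lborel fst)"
      using N fst_borel null_setsD2[OF N] by (simp add: null_sets_distr_iff)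
  qed
qed

lemma snd_lebesgue_measurable:
  "snd \<in> (lebesgue :: ('a::euclidean_space \<times> 'b::euclidean_space) measure) \<rightarrow>\<^sub>M lebesgue"
proof (rule completion.measurable_completion2)
  show snd_borel: "snd \<in> (lebesgue :: ('a \<times> 'b) measure) \<rightarrow>\<^sub>M lborel"
    by (intro measurable_completion) (simp add: borel_measurable_continuous_onI continuous_on_snd)
  show "null_sets lborel \<subseteq> null_sets (distr (lebesgue :: ('a \<times> 'b) measure) lborel snd)"
  proof
    fix N :: "'b set" assume N: "N \<in> null_sets lborel"
    have "(UNIV :: 'a set) \<times> N \<in> null_sets ((lborel :: 'a measure) \<Otimes>\<^sub>M (lborel :: 'b measure))"
      using N by (intro lborel.times_in_null_sets2) auto
    then have "(UNIV :: 'a set) \<times> N \<in> null_sets (lebesgue :: ('a \<times> 'b) measure)"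
      by (simp add: lborel_prod null_sets_completionI)
    moreover have "snd -` N = (UNIV :: 'a set) \<times> N" by auto
    ultimately show "N \<in> null_sets (distr (lebesgue :: ('a \<times> 'b) measure) lborel snd)"
      using N snd_borel null_setsD2[OF N] by (simp add: null_sets_distr_iff)
  qed
qed

section \<open>Densities with uniform margins\<close>

lemma density_indicator_unit_interval:
  "density lborel (indicator {0..1::real}) = uniform_measure lborel {0..1}"
  unfolding uniform_measure_def by (rule arg_cong[where f="density lborel"]) (auto simp: divide_ennreal_def)

lemma distr_fst_density:
  fixes d :: "real \<times> real \<Rightarrow> ennreal"
  assumes d[measurable]: "d \<in> borel_measurable borel"
    and m: "AE u in lborel. (\<integral>\<^sup>+ v. d (u, v) \<partial>lborel) = indicator {0..1} u"
  shows "distr (density lborel d) borel fst = uniform_measure lborel {0..1}"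
  unfolding density_indicator_unit_interval[symmetric]
proof (rule measure_eqI)
  fix B :: "real set" assume "B \<in> sets (distr (density lborel d) borel fst)"
  then have B[measurable]: "B \<in> sets borel" by simp
  have [measurable]: "d \<in> borel_measurable (lborel \<Otimes>\<^sub>M lborel)"
    by (simp add: lborel_prod)
  have [measurable]: "(fst :: real \<times> real \<Rightarrow> real) \<in> borel_measurable borel"
    by (simp add: borel_measurable_continuous_onI continuous_on_fst)
  have pre: "(fst :: real \<times> real \<Rightarrow> real) -` B \<in> sets borel"
    using measurable_sets[of "fst :: real \<times> real \<Rightarrow> real" borel borel B] by simp
  have "emeasure (distr (density lborel d) borel fst) B
      = (\<integral>\<^sup>+ x. d x * indicator B (fst x) \<partial>(lborel \<Otimes>\<^sub>M lborel))"
    using pre by (simp add: emeasure_distr emeasure_density lborel_prod indicator_def vimage_def)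
  also have "\<dots> = (\<integral>\<^sup>+ u. \<integral>\<^sup>+ v. d (u, v) * indicator B u \<partial>lborel \<partial>lborel)"
    by (subst lborel.nn_integral_fst[symmetric]) simp_all
  also have "\<dots> = (\<integral>\<^sup>+ u. (\<integral>\<^sup>+ v. d (u, v) \<partial>lborel) * indicator B u \<partial>lborel)"
    by (intro nn_integral_cong nn_integral_multc) measurable
  also have "\<dots> = (\<integral>\<^sup>+ u. indicator {0..1} u * indicator B u \<partial>lborel)"
    by (rule nn_integral_cong_AE) (use m in eventually_elim, simp)
  finally show "emeasure (distr (density lborel d) borel fst) B
      = emeasure (density lborel (indicator {0..1})) B"
    by (simp add: emeasure_density)
qed simp

lemma distr_snd_density:
  fixes d :: "real \<times> real \<Rightarrow> ennreal"
  assumes d[measurable]: "d \<in> borel_measurable borel"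
    and m: "AE v in lborel. (\<integral>\<^sup>+ u. d (u, v) \<partial>lborel) = indicator {0..1} v"
  shows "distr (density lborel d) borel snd = uniform_measure lborel {0..1}"
  unfolding density_indicator_unit_interval[symmetric]
proof (rule measure_eqI)
  fix B :: "real set" assume "B \<in> sets (distr (density lborel d) borel snd)"
  then have B[measurable]: "B \<in> sets borel" by simp
  have [measurable]: "d \<in> borel_measurable (lborel \<Otimes>\<^sub>M lborel)"
    by (simp add: lborel_prod)
  have [measurable]: "(snd :: real \<times> real \<Rightarrow> real) \<in> borel_measurable borel"
    by (simp add: borel_measurable_continuous_onI continuous_on_snd)
  have pre: "(snd :: real \<times> real \<Rightarrow> real) -` B \<in> sets borel"
    using measurable_sets[of "snd :: real \<times> real \<Rightarrow> real" borel borel B] by simp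
  have "emeasure (distr (density lborel d) borel snd) B
      = (\<integral>\<^sup>+ x. d x * indicator B (snd x) \<partial>(lborel \<Otimes>\<^sub>M lborel))"
    using pre by (simp add: emeasure_distr emeasure_density lborel_prod indicator_def vimage_def)
  also have "\<dots> = (\<integral>\<^sup>+ v. \<integral>\<^sup>+ u. d (u, v) * indicator B v \<partial>lborel \<partial>lborel)"
    by (subst lborel_pair.nn_integral_snd[symmetric]) simp_all
  also have "\<dots> = (\<integral>\<^sup>+ v. (\<integral>\<^sup>+ u. d (u, v) \<partial>lborel) * indicator B v \<partial>lborel)"
    by (intro nn_integral_cong nn_integral_multc) measurable
  also have "\<dots> = (\<integral>\<^sup>+ v. indicator {0..1} v * indicator B v \<partial>lborel)"
    by (rule nn_integral_cong_AE) (use m in eventually_elim, simp)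
  finally show "emeasure (distr (density lborel d) borel snd) B
      = emeasure (density lborel (indicator {0..1})) B"
    by (simp add: emeasure_density)
qed simp

text \<open>
  The measure is a probability measure because its total mass is that of its first margin.
\<close>

lemma bivariate_copula_of_density:
  fixes d :: "real \<times> real \<Rightarrow> ennreal"
  assumes d[measurable]: "d \<in> borel_measurable borel"
    and supp: "\<And>x. x \<notin> unit_square \<Longrightarrow> d x = 0"
    and m1: "AE u in lborel. (\<integral>\<^sup>+ v. d (u, v) \<partial>lborel) = indicator {0..1} u"
    and m2: "AE v in lborel. (\<integral>\<^sup>+ u. d (u, v) \<partial>lborel) = indicator {0..1} v"
  shows "bivariate_copula (\<lambda>(u, v). measure (density lborel d) ({..u} \<times> {..v}))"
proof -
  let ?M = "density lborel d"
  have [measurable]: "(fst :: real \<times> real \<Rightarrow> real) \<in> borel_measurable borel"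
    by (simp add: borel_measurable_continuous_onI continuous_on_fst)
  have one: "emeasure ?M UNIV = 1"
  proof -
    have "emeasure ?M UNIV = emeasure (distr ?M borel fst) UNIV"
      by (subst emeasure_distr) simp_all
    also have "\<dots> = 1"
      by (simp add: distr_fst_density[OF d m1])
    finally show ?thesis .
  qed
  then have "prob_space ?M"
    by (intro prob_spaceI) simp
  moreover have "emeasure ?M unit_square = emeasure ?M UNIV"
  proof -
    have S: "unit_square \<in> sets (borel :: (real \<times> real) measure)"
      by (intro borel_closed closed_Times) auto
    have "d x * indicator unit_square x = d x" for x
      using supp[of x] by (cases "x \<in> unit_square") auto
    then show ?thesis
      using S by (simp add: emeasure_density)
  qed
  ultimately show ?thesis
    unfolding bivariate_copula_def
    by (intro exI[of _ ?M])
      (simp add: one distr_fst_density[OF d m1] distr_snd_density[OF d m2])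
qed

text \<open>
  Almost every slice of a Borel version agrees almost everywhere with the slice of the original
  function, so the two have the same integral. The Bochner integral being 1 rather than the
  default value 0 is what makes the slice integrable.
\<close>

lemma AE_nn_integral_slice:
  fixes k f :: "real \<Rightarrow> real \<Rightarrow> real"
  assumes one: "AE s in lebesgue_on {0..1}. (LINT t|lebesgue_on {0..1}. k s t) = 1"
    and nonneg: "\<And>s t. s \<in> {0..1} \<Longrightarrow> t \<in> {0..1} \<Longrightarrow> 0 \<le> k s t"
    and eq: "AE s in lborel. AE t in lborel. f s t = (if s \<in> {0..1} \<and> t \<in> {0..1} then k s t else 0)"
  shows "AE s in lborel. (\<integral>\<^sup>+ t. ennreal (f s t) \<partial>lborel) = indicator {0..1} s"
proof -
  have "AE s in lborel. s \<in> {0..1} \<longrightarrow> (LINT t|lebesgue_on {0..1}. k s t) = 1"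
    using one by (simp add: AE_restrict_space_iff AE_completion_iff)
  with eq show ?thesis
  proof eventually_elim
    case (elim s)
    let ?k = "\<lambda>t. if s \<in> {0..1} \<and> t \<in> {0..1} then k s t else 0"
    have f_k: "(\<integral>\<^sup>+ t. ennreal (f s t) \<partial>lborel) = (\<integral>\<^sup>+ t. ennreal (?k t) \<partial>lborel)"
      by (rule nn_integral_cong_AE) (use elim(1) in eventually_elim, simp)
    show ?case
    proof (cases "s \<in> {0..1}")
      case True
      have "(LINT t|lebesgue. ?k t) = (LINT t|lebesgue. indicator {0..1} t *\<^sub>R k s t)"
        by (rule Bochner_Integration.integral_cong) (use True in auto)
      then have int: "(LINT t|lebesgue. ?k t) = 1"
        using elim(2) True by (simp add: integral_restrict_space)
      then have "integrable lebesgue ?k"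
        using not_integrable_integral_eq by fastforce
      then have "(\<integral>\<^sup>+ t. ennreal (?k t) \<partial>lebesgue) = ennreal (LINT t|lebesgue. ?k t)"
        by (rule nn_integral_eq_integral) (simp add: nonneg)
      then show ?thesis
        using True int by (simp only: f_k nn_integral_completion) simp
    next
      case False
      then have "?k = (\<lambda>_. 0)" by auto
      then show ?thesis using False by (simp only: f_k) simp
    qed
  qed
qed

text \<open>
  A Borel measure on the plane with density \<open>c\<close>, and Fubini's theorem for it, are available only when
  \<open>c\<close> is Borel measurable. A nonnegative Borel function \<open>h\<close>, zero off the square and equal to \<open>c\<close> almost
  everywhere on it, therefore defines the measure, and all integrals are carried over to \<open>h\<close>.
\<close>

lemma copula_densityI:
  fixes c :: "real \<times> real \<Rightarrow> real"
  assumes meas: "c \<in> borel_measurable (lebesgue_on unit_square)"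
    and nonneg: "\<And>x. x \<in> unit_square \<Longrightarrow> 0 \<le> c x"
    and m1: "AE u in lebesgue_on {0..1}. (LINT v|lebesgue_on {0..1}. c (u, v)) = 1"
    and m2: "AE v in lebesgue_on {0..1}. (LINT u|lebesgue_on {0..1}. c (u, v)) = 1"
  shows "copula_density c"
proof -
  have Sb: "unit_square \<in> sets (borel :: (real \<times> real) measure)"
    by (intro borel_closed closed_Times) auto
  then have Sl: "unit_square \<in> sets (lebesgue :: (real \<times> real) measure)"
    by simp
  define c0 where "c0 x = (if x \<in> unit_square then c x else 0)" for x
  have c0_pair: "c0 (u, v) = (if u \<in> {0..1} \<and> v \<in> {0..1} then c (u, v) else 0)" for u v
    by (simp add: c0_def)
  have c0_nonneg: "0 \<le> c0 x" for x
    using nonneg[of x] by (simp add: c0_def)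
  have c0_lebesgue: "c0 \<in> borel_measurable lebesgue"
    unfolding c0_def[abs_def] using borel_measurable_if_I[OF meas Sl] .
  then obtain g where g: "g \<in> borel_measurable lborel" "AE x in lborel. c0 x = g x"
    using completion_ex_borel_measurable_real by blast
  \<comment> \<open>Truncation makes nonnegativity and support hold everywhere; it changes \<open>g\<close> on a null set only.\<close>
  define h where "h x = (if x \<in> unit_square then max 0 (g x) else 0)" for x
  have h_meas[measurable]: "h \<in> borel_measurable borel"
    unfolding h_def[abs_def] using g(1) Sb by (intro measurable_If_set) auto
  have h_nonneg: "0 \<le> h x" for x by (simp add: h_def)
  have h_supp: "h x = 0" if "x \<notin> unit_square" for x
    using that by (auto simp: h_def)
  have h_eq: "AE x in lborel. h x = c0 x"
    using g(2)
  proof eventually_elim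
    case (elim x)
    then show ?case using c0_nonneg[of x] by (cases "x \<in> unit_square") (simp_all add: h_def c0_def)
  qed
  then have h_eq_pair: "AE x in lborel \<Otimes>\<^sub>M lborel. h x = c0 x"
    unfolding lborel_prod .
  have margin1: "AE u in lborel. (\<integral>\<^sup>+ v. ennreal (h (u, v)) \<partial>lborel) = indicator {0..1} u"
  proof (rule AE_nn_integral_slice[OF m1])
    show "AE u in lborel. AE v in lborel.
        h (u, v) = (if u \<in> {0..1} \<and> v \<in> {0..1} then c (u, v) else 0)"
      using lborel_pair.AE_pair[OF h_eq_pair] by (simp only: c0_pair)
  qed (rule nonneg, simp)
  have margin2: "AE v in lborel. (\<integral>\<^sup>+ u. ennreal (h (u, v)) \<partial>lborel) = indicator {0..1} v"
  proof (rule AE_nn_integral_slice[OF m2])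
    \<comment> \<open>The set where \<open>h\<close> and \<open>c0\<close> agree need not be Borel, so the coordinates are exchanged by the
      swap map, which preserves the product measure.\<close>
    have "AE x in distr (lborel \<Otimes>\<^sub>M lborel) (lborel \<Otimes>\<^sub>M lborel) (\<lambda>(x, y). (y, x)). h x = c0 x"
      using h_eq_pair by (subst (asm) lborel_pair.distr_pair_swap)
    then have "AE x in lborel \<Otimes>\<^sub>M lborel. h (case x of (x, y) \<Rightarrow> (y, x)) = c0 (case x of (x, y) \<Rightarrow> (y, x))"
      by (rule AE_distrD[OF measurable_pair_swap'])
    from lborel_pair.AE_pair[OF this]
    show "AE v in lborel. AE u in lborel.
        h (u, v) = (if v \<in> {0..1} \<and> u \<in> {0..1} then c (u, v) else 0)"
      by (simp only: c0_pair prod.case conj_commute)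
  qed (rule nonneg, simp)
  let ?M = "density lborel (\<lambda>x. ennreal (h x))"
  let ?C = "\<lambda>(u, v). measure ?M ({..u} \<times> {..v})"
  have copula: "bivariate_copula ?C"
    using h_supp by (intro bivariate_copula_of_density margin1 margin2) auto
  have h_total: "(\<integral>\<^sup>+ x. ennreal (h x) \<partial>lborel) = 1"
  proof -
    have "(\<integral>\<^sup>+ x. ennreal (h x) \<partial>lborel) = (\<integral>\<^sup>+ x. ennreal (h x) \<partial>(lborel \<Otimes>\<^sub>M lborel))"
      by (simp add: lborel_prod)
    also have "\<dots> = (\<integral>\<^sup>+ u. \<integral>\<^sup>+ v. ennreal (h (u, v)) \<partial>lborel \<partial>lborel)"
      by (subst lborel.nn_integral_fst[symmetric]) (simp_all add: lborel_prod)
    also have "\<dots> = (\<integral>\<^sup>+ u. indicator {0..1::real} u \<partial>lborel)"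
      by (rule nn_integral_cong_AE) (rule margin1)
    also have "\<dots> = 1" by simp
    finally show ?thesis .
  qed
  have c0_h: "AE x in lebesgue. h x = c0 x"
    using h_eq by (rule AE_completion)
  have "integrable lborel h"
    using h_total h_nonneg by (intro integrableI_nonneg) auto
  then have "integrable lebesgue h"
    by (simp add: integrable_completion)
  then have "integrable lebesgue c0"
    using c0_h c0_lebesgue by (subst integrable_cong_AE) auto
  moreover have "c0 = (\<lambda>x. indicator unit_square x *\<^sub>R c x)"
    by (auto simp: c0_def fun_eq_iff indicator_def)
  ultimately have c_int: "integrable (lebesgue_on unit_square) c"
    using Sl by (simp add: integrable_restrict_space)
  have cdf: "?C (u, v) = (LINT x|lebesgue_on ({0..u} \<times> {0..v}). c x)"
    if uv: "u \<in> {0..1}" "v \<in> {0..1}" for u v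
  proof -
    let ?R = "{0..u} \<times> {0..v}"
    have Rb: "?R \<in> sets borel" "{..u} \<times> {..v} \<in> sets borel"
      by (intro borel_closed closed_Times; auto)+
    have R: "?R \<subseteq> unit_square" using uv by auto
    have cut: "ennreal (h x) * indicator ({..u} \<times> {..v}) x = ennreal (indicator ?R x * h x)" for x
      using h_supp[of x] by (cases x) (auto simp: indicator_def)
    have restrict: "indicator ?R x *\<^sub>R c x = indicator ?R x * c0 x" for x
      using subsetD[OF R, of x] by (cases "x \<in> ?R") (simp_all add: c0_def)
    have "(LINT x|lebesgue_on ?R. c x) = (LINT x|lebesgue. indicator ?R x *\<^sub>R c x)"
      using Rb by (intro integral_restrict_space) auto
    also have "\<dots> = (LINT x|lebesgue. indicator ?R x * c0 x)"
      by (simp only: restrict)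
    also have "\<dots> = (LINT x|lebesgue. indicator ?R x * h x)"
      using c0_h c0_lebesgue Rb by (intro integral_cong_AE borel_measurable_times borel_measurable_indicator)
        (auto intro: measurable_completion)
    also have "\<dots> = (LINT x|lborel. indicator ?R x * h x)"
      using Rb by (intro integral_completion) auto
    also have "\<dots> = enn2real (\<integral>\<^sup>+ x. ennreal (indicator ?R x * h x) \<partial>lborel)"
      using Rb h_nonneg by (intro integral_eq_nn_integral) auto
    also have "\<dots> = ?C (u, v)"
      using Rb by (simp add: measure_def emeasure_density cut)
    finally show ?thesis by simp
  qed
  show ?thesis
    unfolding copula_density_def density_of_cdf_def
    using nonneg m1 m2 copula c_int cdf by blast
qed

section \<open>Bilinear forms in orthonormal functions\<close>

lemma scalar_prod_mult_mat_vec_eq_sum: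
  fixes A :: "real mat"
  assumes "A \<in> carrier_mat p p" "x \<in> carrier_vec p" "y \<in> carrier_vec p"
  shows "x \<bullet> (A *\<^sub>v y) = (\<Sum>i<p. \<Sum>j<p. A $$ (i, j) * (x $ i * y $ j))"
  using assms
  by (auto simp: scalar_prod_def sum_distrib_left atLeast0LessThan mult_ac intro!: sum.cong)

lemma mult_mat_vec_first_unit:
  fixes A :: "real mat"
  assumes "A \<in> carrier_mat p p" "0 < p" "A *\<^sub>v unit_vec p 0 = unit_vec p 0" "i < p"
  shows "A $$ (i, 0) = (if i = 0 then 1 else 0)"
proof -
  have "A $$ (i, 0) = (A *\<^sub>v unit_vec p 0) $ i"
    using assms(1,2,4) by simp
  also have "\<dots> = unit_vec p 0 $ i"
    by (simp only: assms(3))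
  finally show ?thesis
    using assms(2,4) by simp
qed

text \<open>
  Every \<open>\<phi>\<^sub>i\<close> has integral \<open>\<delta>\<^sub>i\<^sub>0\<close>, since this is its inner product with \<open>\<phi>\<^sub>0 = 1\<close>. Integrating out one
  variable of the bilinear form therefore leaves the combination of the functions \<open>\<phi>\<^sub>i\<close> whose
  coefficients are the first column or the first row of \<open>A\<close>. Both are the first unit vector, so
  the margin is \<open>\<phi>\<^sub>0 = 1\<close>, at every point.
\<close>

lemma copula_density_of_mem_C_set:
  fixes p :: nat and \<phi> :: "real \<Rightarrow> real vec"
  assumes p: "0 < p"
    and dim: "\<And>t. t \<in> {0..1} \<Longrightarrow> \<phi> t \<in> carrier_vec p"
    and orth: "orthonormal_L2 p \<phi>"
    and first: "\<And>t. t \<in> {0..1} \<Longrightarrow> \<phi> t $ 0 = 1"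
    and c: "c \<in> C_set p \<phi>"
  shows "copula_density c"
proof -
  obtain A where A_in: "A \<in> A_set p \<phi>"
    and c_eq: "\<And>u v. u \<in> {0..1} \<Longrightarrow> v \<in> {0..1} \<Longrightarrow> c (u, v) = \<phi> u \<bullet> (A *\<^sub>v \<phi> v)"
    using c unfolding C_set_def by blast
  have A: "A \<in> carrier_mat p p" "A *\<^sub>v unit_vec p 0 = unit_vec p 0"
      "transpose_mat A *\<^sub>v unit_vec p 0 = unit_vec p 0"
    and A_nonneg: "\<And>u v. u \<in> {0..1} \<Longrightarrow> v \<in> {0..1} \<Longrightarrow> 0 \<le> \<phi> u \<bullet> (A *\<^sub>v \<phi> v)"
    using A_in unfolding A_set_def by blast+
  have col: "A $$ (i, 0) = (if i = 0 then 1 else 0)" if "i < p" for i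
    using mult_mat_vec_first_unit[OF A(1) p A(2) that] .
  have row: "A $$ (0, j) = (if j = 0 then 1 else 0)" if "j < p" for j
    using mult_mat_vec_first_unit[OF _ p A(3) that] A(1) p that by simp
  have c_sum: "c (u, v) = (\<Sum>i<p. \<Sum>j<p. A $$ (i, j) * (\<phi> u $ i * \<phi> v $ j))"
    if "u \<in> {0..1}" "v \<in> {0..1}" for u v
    using that A(1) dim by (simp add: c_eq scalar_prod_mult_mat_vec_eq_sum)
  have meas: "(\<lambda>t. \<phi> t $ i) \<in> borel_measurable (lebesgue_on {0..1})"
    and square: "integrable (lebesgue_on {0..1}) (\<lambda>t. (\<phi> t $ i)\<^sup>2)" if "i < p" for i
    using orth that unfolding orthonormal_L2_def by blast+
  have inner: "(LINT t|lebesgue_on {0..1}. \<phi> t $ i * \<phi> t $ j) = (if i = j then 1 else 0)"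
    if "i < p" "j < p" for i j
    using orth that unfolding orthonormal_L2_def by blast
  have mean: "has_bochner_integral (lebesgue_on {0..1}) (\<lambda>t. \<phi> t $ i) (if i = 0 then 1 else 0)"
    if "i < p" for i
  proof -
    interpret finite_measure "lebesgue_on {0..1::real}"
      by (rule finite_measure_lebesgue_on) simp
    have "integrable (lebesgue_on {0..1}) (\<lambda>t. \<phi> t $ i)"
      using meas[OF that] square[OF that] by (rule square_integrable_imp_integrable)
    moreover
    have "(LINT t|lebesgue_on {0..1}. \<phi> t $ i) = (LINT t|lebesgue_on {0..1}. \<phi> t $ i * \<phi> t $ 0)"
      by (rule Bochner_Integration.integral_cong) (auto simp: first)
    ultimately show ?thesis
      by (simp only: inner[OF that p] has_bochner_integral_iff)
  qed
  have margin1: "(LINT v|lebesgue_on {0..1}. c (u, v)) = 1" if u: "u \<in> {0..1}" for u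
  proof -
    have "(LINT v|lebesgue_on {0..1}. c (u, v))
        = (LINT v|lebesgue_on {0..1}. (\<Sum>i<p. \<Sum>j<p. A $$ (i, j) * (\<phi> u $ i * \<phi> v $ j)))"
      by (rule Bochner_Integration.integral_cong) (use u in \<open>auto simp: c_sum\<close>)
    also have "\<dots> = (\<Sum>i<p. \<Sum>j<p. A $$ (i, j) * (\<phi> u $ i * (if j = 0 then 1 else 0)))"
      by (intro has_bochner_integral_integral_eq has_bochner_integral_sum
          has_bochner_integral_mult_right has_bochner_integral_mult_left mean) auto
    also have "\<dots> = (\<Sum>i<p. A $$ (i, 0) * \<phi> u $ i)"
      using p by (simp add: if_distrib sum.delta cong: if_cong)
    also have "\<dots> = (\<Sum>i<p. if i = 0 then \<phi> u $ i else 0)"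
      by (rule sum.cong) (auto simp: col)
    also have "\<dots> = 1"
      using p u by (simp add: first)
    finally show ?thesis .
  qed
  have margin2: "(LINT u|lebesgue_on {0..1}. c (u, v)) = 1" if v: "v \<in> {0..1}" for v
  proof -
    have "(LINT u|lebesgue_on {0..1}. c (u, v))
        = (LINT u|lebesgue_on {0..1}. (\<Sum>i<p. \<Sum>j<p. A $$ (i, j) * (\<phi> u $ i * \<phi> v $ j)))"
      by (rule Bochner_Integration.integral_cong) (use v in \<open>auto simp: c_sum\<close>)
    also have "\<dots> = (\<Sum>i<p. \<Sum>j<p. A $$ (i, j) * ((if i = 0 then 1 else 0) * \<phi> v $ j))"
      by (intro has_bochner_integral_integral_eq has_bochner_integral_sum
          has_bochner_integral_mult_right has_bochner_integral_mult_left mean) auto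
    also have "\<dots> = (\<Sum>j<p. \<Sum>i<p. A $$ (i, j) * ((if i = 0 then 1 else 0) * \<phi> v $ j))"
      by (rule sum.swap)
    also have "\<dots> = (\<Sum>j<p. A $$ (0, j) * \<phi> v $ j)"
      using p by (simp add: if_distrib if_distribR sum.delta cong: if_cong)
    also have "\<dots> = (\<Sum>j<p. if j = 0 then \<phi> v $ j else 0)"
      by (rule sum.cong) (auto simp: row)
    also have "\<dots> = 1"
      using p v by (simp add: first)
    finally show ?thesis .
  qed
  have c_meas: "c \<in> borel_measurable (lebesgue_on unit_square)"
  proof -
    have f1: "fst \<in> lebesgue_on unit_square \<rightarrow>\<^sub>M lebesgue_on {0..1::real}"
      by (intro measurable_restrict_space3 fst_lebesgue_measurable) auto
    have f2: "snd \<in> lebesgue_on unit_square \<rightarrow>\<^sub>M lebesgue_on {0..1::real}"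
      by (intro measurable_restrict_space3 snd_lebesgue_measurable) auto
    have m1: "(\<lambda>x. \<phi> (fst x) $ i) \<in> borel_measurable (lebesgue_on unit_square)" if "i < p" for i
      using measurable_compose[OF f1 meas[OF that]] .
    have m2: "(\<lambda>x. \<phi> (snd x) $ i) \<in> borel_measurable (lebesgue_on unit_square)" if "i < p" for i
      using measurable_compose[OF f2 meas[OF that]] .
    have "(\<lambda>x. \<Sum>i<p. \<Sum>j<p. A $$ (i, j) * (\<phi> (fst x) $ i * \<phi> (snd x) $ j))
        \<in> borel_measurable (lebesgue_on unit_square)"
      by (intro borel_measurable_sum borel_measurable_times borel_measurable_const m1 m2) auto
    then show ?thesis
      by (rule measurable_cong[THEN iffD1, rotated]) (auto simp: c_sum)
  qed
  show ?thesis
  proof (rule copula_densityI[OF c_meas])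
    show "0 \<le> c x" if "x \<in> unit_square" for x
      using that A_nonneg c_eq by auto
    show "AE u in lebesgue_on {0..1}. (LINT v|lebesgue_on {0..1}. c (u, v)) = 1"
      by (rule AE_I2) (simp add: margin1)
    show "AE v in lebesgue_on {0..1}. (LINT u|lebesgue_on {0..1}. c (u, v)) = 1"
      by (rule AE_I2) (simp add: margin2)
  qed
qed

text \<open>
  The density of the independence copula comes from the matrix whose only nonzero entry is a 1 in
  the top left corner.
\<close>

lemma constant_one_in_C_set:
  fixes p :: nat and \<phi> :: "real \<Rightarrow> real vec"
  assumes p: "0 < p"
    and dim: "\<And>t. t \<in> {0..1} \<Longrightarrow> \<phi> t \<in> carrier_vec p"
    and first: "\<And>t. t \<in> {0..1} \<Longrightarrow> \<phi> t $ 0 = 1"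
  shows "restrict (\<lambda>_. 1) unit_square \<in> C_set p \<phi>"
proof -
  define E :: "real mat" where "E = mat p p (\<lambda>(i, j). if i = 0 \<and> j = 0 then 1 else 0)"
  have E: "E \<in> carrier_mat p p" by (simp add: E_def)
  have E_form: "\<phi> u \<bullet> (E *\<^sub>v \<phi> v) = 1" if "u \<in> {0..1}" "v \<in> {0..1}" for u v
  proof -
    have "\<phi> u \<bullet> (E *\<^sub>v \<phi> v) = (\<Sum>i<p. \<Sum>j<p. E $$ (i, j) * (\<phi> u $ i * \<phi> v $ j))"
      using that E dim by (intro scalar_prod_mult_mat_vec_eq_sum) auto
    also have "\<dots> = (\<Sum>i<p. \<Sum>j<p. if j = 0 then (if i = 0 then \<phi> u $ i * \<phi> v $ j else 0) else 0)"
      by (intro sum.cong) (auto simp: E_def)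
    also have "\<dots> = 1"
      using p that by (simp add: first)
    finally show ?thesis .
  qed
  have "E \<in> A_set p \<phi>"
    unfolding A_set_def using p E by (auto simp: E_form) (auto simp: E_def)
  then show ?thesis
    unfolding C_set_def using E_form by (auto intro!: bexI[of _ E])
qed

theorem proposition1:
  fixes p :: nat and \<phi> :: "real \<Rightarrow> real vec"
  assumes "p \<ge> 2"
    and "\<And>t. t \<in> {0..1} \<Longrightarrow> \<phi> t \<in> carrier_vec p"
    and "orthonormal_L2 p \<phi>"
    and "\<And>t. t \<in> {0..1} \<Longrightarrow> vec_index (\<phi> t) 0 = 1"
  shows "C_set p \<phi> \<noteq> {} \<and> (\<forall>c\<in>C_set p \<phi>. copula_density c)"
proof -
  have "0 < p" using assms(1) by simp
  then show ?thesis
    using constant_one_in_C_set[of p \<phi>] copula_density_of_mem_C_set[of p \<phi>] assms by blast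
qed

end
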